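(* There is an absolute constant $c>0$ such that every ID-generation algorithm $\mathcal A$ has competitive ratio at least $c\log m$ for $\mathcal{D} = [\sqrt{m}]^2$, i.e., $\max_{D\in[\sqrt m]^2} p_{\mathcal A}(D)/p_*(D) = \Omega(\log m)$.
   Context: Fix $m\in\mathbb N$ and the universe of IDs $[m]=\{1,\dots,m\}$. An ID-generation algorithm $\mathcal A$ is a probability distribution over permutations of $[m]$: an instance draws a permutation and answers its $t$-th request with the $t$-th entry. A demand profile $D=(d_1,\dots,d_n)$ means $n$ instances of $\mathcal A$ with independent randomness, instance $i$ receiving $d_i$ requests one at a time without knowing $d_i$ in advance. A collision occurs if the sets of IDs output by the instances are not pairwise disjoint; $p_{\mathcal A}(D)$ is the collision probability and $p_*(D)=\min_{\mathcal A'}p_{\mathcal A'}(D)$ over all algorithms. $[\sqrt m]^2$ is the set of demand profiles $(d_1,d_2)$ with two instances and $1\le d_1,d_2\le \sqrt m$. The competitive ratio of $\mathcal A$ for a set $\mathcal D$ of demand profiles with at least two entries is $\max_{D\in\mathcal D}p_{\mathcal A}(D)/p_*(D)$. *)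

theory Defs
  imports "HOL-Probability.Probability" "HOL-Combinatorics.Permutations"
begin

text \<open>
  An algorithm for the universe \<open>{1..m}\<close> of IDs is a probability distribution on the permutations
  of \<open>{1..m}\<close>; the \<open>t\<close>-th request (\<open>1 \<le> t \<le> m\<close>) to an instance that drew \<open>\<sigma>\<close> is answered by \<open>\<sigma> t\<close>.
\<close>

definition id_algorithm :: "nat \<Rightarrow> (nat \<Rightarrow> nat) pmf \<Rightarrow> bool" where
  "id_algorithm m A \<longleftrightarrow> set_pmf A \<subseteq> {\<sigma>. \<sigma> permutes {1..m}}"

text \<open>
  A demand profile is the list of its demands, so instances are numbered from 0. All demands
  are meant to be between 1 and \<open>m\<close>.
\<close>

type_synonym demand_profile = "nat list"

definition collision :: "demand_profile \<Rightarrow> (nat \<Rightarrow> nat \<Rightarrow> nat) \<Rightarrow> bool" where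
  "collision D \<sigma> \<longleftrightarrow> \<not> disjoint_family_on (\<lambda>i. \<sigma> i ` {1..D ! i}) {..<length D}"

definition collision_prob :: "(nat \<Rightarrow> nat) pmf \<Rightarrow> demand_profile \<Rightarrow> real" where
  "collision_prob A D =
     measure_pmf.prob (Pi_pmf {..<length D} id (\<lambda>_. A)) {\<sigma>. collision D \<sigma>}"

text \<open>
  The infimum is a minimum: the algorithms for \<open>m\<close> form a compact simplex, on which the collision
  probability of a fixed profile is a polynomial. For at least two positive demands it is
  positive, since independent instances draw the same permutation with probability at least
  \<open>1 / fact m\<close>; so the quotients below are never divisions by zero.
\<close>

definition opt_collision_prob :: "nat \<Rightarrow> demand_profile \<Rightarrow> real" where
  "opt_collision_prob m D = (INF A\<in>{A. id_algorithm m A}. collision_prob A D)"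

text \<open>
  The set of quotients is finite even for an infinite set of profiles, because a profile with
  more than \<open>m\<close> positive demands always collides and thus has quotient 1.
\<close>

definition competitive_ratio ::
  "nat \<Rightarrow> (nat \<Rightarrow> nat) pmf \<Rightarrow> demand_profile set \<Rightarrow> real" where
  "competitive_ratio m A \<D> =
     Max ((\<lambda>D. collision_prob A D / opt_collision_prob m D) ` \<D>)"

definition sqrt_pair_profiles :: "nat \<Rightarrow> demand_profile set" where
  "sqrt_pair_profiles m =
     {[d1, d2] | d1 d2. 1 \<le> d1 \<and> real d1 \<le> sqrt (real m) \<and> 1 \<le> d2 \<and> real d2 \<le> sqrt (real m)}"

end

theory Submission imports Defs begin

text \<open>
  Let \<open>R\<close> be the competitive ratio. For demands \<open>a \<le> b\<close> the optimum is \<open>O(a / m)\<close>, because only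
  the first \<open>a\<close> requests have to be randomised; hence \<open>A\<close> collides on \<open>[a, b]\<close> with probability
  \<open>O(R a / m)\<close>. Split the first \<open>2 ^ L\<close> requests, about \<open>sqrt m\<close> many, into dyadic blocks
  \<open>B i = {2 ^ i..<2 ^ (i + 1)}\<close>, and let \<open>F i x\<close> be the probability that an instance outputs \<open>x\<close>
  during block \<open>i\<close>. The numbers \<open>F i x / 2 ^ i\<close>, over all \<open>i < L\<close> and all IDs \<open>x\<close>, sum to \<open>L\<close>, so
  by Cauchy-Schwarz the squares of the partial sums over \<open>i\<close> sum over \<open>x\<close> to at least
  \<open>L\<^sup>2 / m\<close>. Expanding the squares yields the expected overlaps of block \<open>i\<close> of one instance with block \<open>j\<close> of another, divided by
  \<open>2 ^ (i + j)\<close>. Such an overlap has size at most \<open>2 ^ min i j\<close> and requires a collision, so the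
  terms are \<open>O(R 2 ^ (- \<bar>i - j\<bar>) / m)\<close> and their sum is \<open>O(R L / m)\<close>. Thus \<open>R = \<Omega>(L)\<close>.
\<close>

section \<open>Two independent instances and their expected overlap\<close>

lemma collision_prob_pair:
  "collision_prob A [d1, d2] =
     measure_pmf.prob (pair_pmf A A) {(f, g). f ` {1..d1} \<inter> g ` {1..d2} \<noteq> {}}"
proof -
  have "{..<length [d1, d2]} = insert 0 {Suc 0}"
    by auto
  then have "Pi_pmf {..<length [d1, d2]} id (\<lambda>_. A) =
      map_pmf (\<lambda>(f, g). g(0 := f)) (pair_pmf A (Pi_pmf {Suc 0} id (\<lambda>_. A)))"
    by (simp add: Pi_pmf_insert)
  also have "\<dots> = map_pmf (\<lambda>(f, g). (\<lambda>b. if b = Suc 0 then g else id)(0 := f)) (pair_pmf A A)"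
    by (simp add: Pi_pmf_singleton pair_map_pmf2 pmf.map_comp o_def case_prod_unfold)
  finally have "collision_prob A [d1, d2] = measure_pmf.prob (pair_pmf A A)
      ((\<lambda>(f, g). (\<lambda>b. if b = Suc 0 then g else id)(0 := f)) -` {\<sigma>. collision [d1, d2] \<sigma>})"
    by (simp add: collision_prob_def)
  also have "(\<lambda>(f, g). (\<lambda>b. if b = Suc 0 then g else id)(0 := f)) -` {\<sigma>. collision [d1, d2] \<sigma>} =
      {(f, g). f ` {1..d1} \<inter> g ` {1..d2} \<noteq> {}}"
    by (fastforce simp: collision_def disjoint_family_on_def lessThan_Suc)
  finally show ?thesis .
qed

lemma collision_prob_nonneg: "0 \<le> collision_prob A D"
  by (simp add: collision_prob_def)

text \<open>Linearity of expectation: the cardinality is a sum of membership indicators over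
  \<open>U\<close>.\<close>

lemma expectation_card:
  assumes "finite (set_pmf P)" "finite U" "\<And>\<omega>. \<omega> \<in> set_pmf P \<Longrightarrow> f \<omega> \<subseteq> U"
  shows "measure_pmf.expectation P (\<lambda>\<omega>. real (card (f \<omega>))) =
    (\<Sum>x\<in>U. measure_pmf.prob P {\<omega>. x \<in> f \<omega>})"
proof -
  have "measure_pmf.expectation P (\<lambda>\<omega>. real (card (f \<omega>))) =
      measure_pmf.expectation P (\<lambda>\<omega>. \<Sum>x\<in>U. indicator {\<omega>. x \<in> f \<omega>} \<omega>)"
  proof (intro integral_cong_AE AE_pmfI)
    fix \<omega> assume "\<omega> \<in> set_pmf P"
    then have "f \<omega> = {x \<in> U. x \<in> f \<omega>}" using assms(3) by auto
    then have "real (card (f \<omega>)) = real (card {x \<in> U. x \<in> f \<omega>})" by simp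
    also have "\<dots> = (\<Sum>x\<in>U. indicator {\<omega>. x \<in> f \<omega>} \<omega>)"
      using assms(2) by (simp add: indicator_def sum.If_cases Int_def)
    finally show "real (card (f \<omega>)) = (\<Sum>x\<in>U. indicator {\<omega>. x \<in> f \<omega>} \<omega>)" .
  qed auto
  also have "\<dots> = (\<Sum>x\<in>U. measure_pmf.prob P {\<omega>. x \<in> f \<omega>})"
    by (subst Bochner_Integration.integral_sum)
       (auto intro: integrable_measure_pmf_finite assms(1))
  finally show ?thesis .
qed

lemma prob_pair_pmf_Times:
  "measure_pmf.prob (pair_pmf P Q) (A \<times> B) = measure_pmf.prob P A * measure_pmf.prob Q B"
proof -
  \<comment> \<open>Cutting both factors down to the supports makes them countable, as
    \<open>measure_pmf_prob_product\<close> demands.\<close>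
  have "measure_pmf.prob (pair_pmf P Q) (A \<times> B) =
      measure_pmf.prob (pair_pmf P Q) ((A \<inter> set_pmf P) \<times> (B \<inter> set_pmf Q))"
    by (intro measure_pmf.finite_measure_eq_AE AE_pmfI) auto
  also have "\<dots> = measure_pmf.prob P (A \<inter> set_pmf P) * measure_pmf.prob Q (B \<inter> set_pmf Q)"
    by (intro measure_pmf_prob_product) auto
  finally show ?thesis by (simp add: measure_Int_set_pmf)
qed

text \<open>With a dyadic block for \<open>B\<close>, these are the numbers \<open>F i x\<close>
  above.\<close>

definition hit_prob :: "(nat \<Rightarrow> nat) pmf \<Rightarrow> nat set \<Rightarrow> nat \<Rightarrow> real" where
  "hit_prob A B x = measure_pmf.prob A {\<sigma>. x \<in> \<sigma> ` B}"

lemma id_algorithm_finite: "id_algorithm m A \<Longrightarrow> finite (set_pmf A)"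
  unfolding id_algorithm_def by (rule finite_subset[OF _ finite_permutations]) auto

text \<open>The sum is the expected size of the image of \<open>B\<close>, and permutations preserve
  cardinalities.\<close>

lemma sum_hit_prob:
  assumes "id_algorithm m A" "B \<subseteq> {1..m}"
  shows "(\<Sum>x\<in>{1..m}. hit_prob A B x) = card B"
proof -
  have perm: "\<sigma> permutes {1..m}" if "\<sigma> \<in> set_pmf A" for \<sigma>
    using that assms(1) by (auto simp: id_algorithm_def)
  have "(\<Sum>x\<in>{1..m}. hit_prob A B x) = measure_pmf.expectation A (\<lambda>\<sigma>. real (card (\<sigma> ` B)))"
    unfolding hit_prob_def
    by (rule expectation_card[symmetric])
       (use assms perm permutes_image in \<open>fastforce simp: id_algorithm_finite\<close>)+
  also have "\<dots> = measure_pmf.expectation A (\<lambda>\<sigma>. real (card B))"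
  proof (intro integral_cong_AE AE_pmfI)
    fix \<sigma> assume "\<sigma> \<in> set_pmf A"
    then have "inj_on \<sigma> B" using perm permutes_inj inj_on_subset by blast
    then show "real (card (\<sigma> ` B)) = real (card B)" by (simp add: card_image)
  qed auto
  finally show ?thesis by simp
qed

text \<open>
  The left-hand side is the expected number of common IDs, which is at most \<open>card B\<close> and
  vanishes unless there is a collision.
\<close>

lemma sum_hit_prob_mult_le:
  assumes A: "id_algorithm m A" and B: "B \<subseteq> {1..m}" "B \<subseteq> {1..d1}"
    and B': "B' \<subseteq> {1..d2}"
  shows "(\<Sum>x\<in>{1..m}. hit_prob A B x * hit_prob A B' x) \<le> card B * collision_prob A [d1, d2]"
proof -
  let ?P = "pair_pmf A A"
  let ?C = "{(f, g). f ` {1..d1} \<inter> g ` {1..d2} \<noteq> {}} :: ((nat \<Rightarrow> nat) \<times> (nat \<Rightarrow> nat)) set"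
  have fin: "finite (set_pmf ?P)" using A by (simp add: id_algorithm_finite)
  have finB: "finite B" using B(1) finite_subset by blast
  have "hit_prob A B x * hit_prob A B' x =
      measure_pmf.prob ?P {\<omega>. x \<in> fst \<omega> ` B \<inter> snd \<omega> ` B'}" for x
  proof -
    have "measure_pmf.prob ?P {\<omega>. x \<in> fst \<omega> ` B \<inter> snd \<omega> ` B'} =
      measure_pmf.prob ?P ({\<sigma>. x \<in> \<sigma> ` B} \<times> {\<sigma>. x \<in> \<sigma> ` B'})"
      by (rule arg_cong[where f = "measure_pmf.prob ?P"]) (simp add: set_eq_iff mem_Times_iff)
    then show ?thesis
      unfolding hit_prob_def by (simp only: prob_pair_pmf_Times)
  qed
  then have "(\<Sum>x\<in>{1..m}. hit_prob A B x * hit_prob A B' x) =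
      (\<Sum>x\<in>{1..m}. measure_pmf.prob ?P {\<omega>. x \<in> fst \<omega> ` B \<inter> snd \<omega> ` B'})"
    by simp
  also have "\<dots> = measure_pmf.expectation ?P (\<lambda>\<omega>. real (card (fst \<omega> ` B \<inter> snd \<omega> ` B')))"
  proof (rule expectation_card[symmetric])
    fix \<omega> assume "\<omega> \<in> set_pmf ?P"
    then have "fst \<omega> permutes {1..m}" using A by (auto simp: id_algorithm_def)
    then show "fst \<omega> ` B \<inter> snd \<omega> ` B' \<subseteq> {1..m}"
      using image_mono[OF B(1), of "fst \<omega>"] by (auto simp: permutes_image)
  qed (use fin in auto)
  also have "\<dots> \<le> measure_pmf.expectation ?P (\<lambda>\<omega>. real (card B) * indicator ?C \<omega>)"
  proof (intro integral_mono integrable_measure_pmf_finite fin)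
    fix \<omega> :: "(nat \<Rightarrow> nat) \<times> (nat \<Rightarrow> nat)"
    show "real (card (fst \<omega> ` B \<inter> snd \<omega> ` B')) \<le> real (card B) * indicator ?C \<omega>"
    proof (cases "\<omega> \<in> ?C")
      case True
      have "card (fst \<omega> ` B \<inter> snd \<omega> ` B') \<le> card (fst \<omega> ` B)"
        using finB by (intro card_mono) auto
      also have "\<dots> \<le> card B" by (rule card_image_le[OF finB])
      finally show ?thesis using True by simp
    next
      case False
      then have "fst \<omega> ` B \<inter> snd \<omega> ` B' = {}"
        using image_mono[OF B(2), of "fst \<omega>"] image_mono[OF B', of "snd \<omega>"]
        by (simp add: case_prod_unfold) blast
      then show ?thesis by simp
    qed
  qed
  also have "\<dots> = card B * collision_prob A [d1, d2]"
    by (simp add: collision_prob_pair)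
  finally show ?thesis .
qed

section \<open>Positivity of the optimum\<close>

lemma sum_squared_le_card:
  fixes g :: "'a \<Rightarrow> real"
  shows "(\<Sum>x\<in>I. g x)\<^sup>2 \<le> card I * (\<Sum>x\<in>I. (g x)\<^sup>2)"
  using Cauchy_Schwarz_ineq_sum[of "\<lambda>_. 1" g I] by simp

text \<open>The first requests alone collide this often: by Cauchy-Schwarz, two independent draws
  from a distribution on \<open>m\<close> IDs agree with probability at least
  \<open>1 / m\<close>.\<close>

lemma collision_prob_ge:
  assumes A: "id_algorithm m A" and "1 \<le> m" "1 \<le> d1" "1 \<le> d2"
  shows "1 / real m \<le> collision_prob A [d1, d2]"
proof -
  have "1 = (\<Sum>x\<in>{1..m}. hit_prob A {1} x)\<^sup>2"
    using sum_hit_prob[OF A, of "{1}"] assms by simp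
  also have "\<dots> \<le> card {1..m} * (\<Sum>x\<in>{1..m}. (hit_prob A {1} x)\<^sup>2)"
    by (rule sum_squared_le_card)
  also have "\<dots> \<le> m * collision_prob A [d1, d2]"
    using sum_hit_prob_mult_le[OF A, of "{1}" d1 "{1}" d2] assms
    by (auto simp: power2_eq_square intro!: mult_left_mono)
  finally show ?thesis using assms by (simp add: field_simps)
qed

lemma opt_collision_prob_le:
  "id_algorithm m A \<Longrightarrow> opt_collision_prob m D \<le> collision_prob A D"
  unfolding opt_collision_prob_def
  by (rule cINF_lower) (auto intro!: bdd_belowI2[where m = 0] collision_prob_nonneg)

lemma opt_collision_prob_pos:
  assumes "1 \<le> m" "1 \<le> d1" "1 \<le> d2"
  shows "0 < opt_collision_prob m [d1, d2]"
proof -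
  \<comment> \<open>Some algorithm must exist for the infimum to be bounded below.\<close>
  have "id_algorithm m (return_pmf id)"
    by (simp add: id_algorithm_def permutes_id)
  then have "1 / real m \<le> opt_collision_prob m [d1, d2]"
    unfolding opt_collision_prob_def
    by (intro cINF_greatest) (use assms collision_prob_ge in auto)
  then show ?thesis using assms by (auto intro: less_le_trans[rotated])
qed

section \<open>Upper bound for the optimum by random blocks\<close>

definition swap_block :: "nat \<Rightarrow> nat \<Rightarrow> nat \<Rightarrow> nat \<Rightarrow> nat" where
  "swap_block a b k t =
     (if 1 \<le> t \<and> t \<le> a then b + k * a + t
      else if b + k * a + 1 \<le> t \<and> t \<le> b + k * a + a then t - (b + k * a) else t)"

text \<open>As \<open>a \<le> b\<close>, the two exchanged ranges are disjoint, so the map is an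
  involution.\<close>

lemma swap_block_permutes:
  assumes "a \<le> b" "b + k * a + a \<le> m"
  shows "swap_block a b k permutes {1..m}"
proof (rule bij_imp_permutes)
  have inv: "swap_block a b k (swap_block a b k t) = t" for t
    using assms(1) by (auto simp: swap_block_def)
  have into: "swap_block a b k t \<in> {1..m}" if "t \<in> {1..m}" for t
    using that assms by (auto simp: swap_block_def)
  show "bij_betw (swap_block a b k) {1..m} {1..m}"
    by (rule bij_betw_byWitness[where f' = "swap_block a b k"]) (use inv into in auto)
  show "swap_block a b k x = x" if "x \<notin> {1..m}" for x
    using that assms by (auto simp: swap_block_def)
qed

text \<open>Requests up to \<open>a\<close> get IDs above \<open>b\<close>, from disjoint blocks for
  \<open>k\<close> and \<open>l\<close>; requests from \<open>a + 1\<close> to \<open>b\<close> are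
  fixed points and thus get IDs at most \<open>b\<close>.\<close>

lemma swap_block_disjoint:
  assumes "a \<le> b" "k \<noteq> l"
  shows "swap_block a b k ` {1..a} \<inter> swap_block a b l ` {1..b} = {}"
proof -
  have "swap_block a b k s \<noteq> swap_block a b l t" if s: "s \<in> {1..a}" and t: "t \<in> {1..b}" for s t
  proof (cases "t \<le> a")
    case False
    then show ?thesis using s t by (auto simp: swap_block_def)
  next
    case True
    have "k * a + s \<noteq> l * a + t"
    proof (cases "k < l")
      case True
      then have "(k + 1) * a \<le> l * a" by (intro mult_right_mono) auto
      then show ?thesis using s t by auto
    next
      case False
      then have "(l + 1) * a \<le> k * a" using assms(2) by (intro mult_right_mono) auto
      then show ?thesis using s t True by auto
    qed
    then show ?thesis using s t True by (auto simp: swap_block_def)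
  qed
  then show ?thesis by blast
qed

text \<open>
  With both demands known, the first \<open>a\<close> requests are answered by a random block, all further
  ones by the same IDs in every instance. Then \<open>a\<close> requests collide with \<open>b\<close> requests only if the
  blocks agree.
\<close>

lemma opt_collision_prob_upper:
  assumes "1 \<le> a" "a \<le> b" "2 * b \<le> m"
  shows "opt_collision_prob m [a, b] \<le> 4 * real a / real m"
proof -
  \<comment> \<open>One half of the IDs has room for \<open>{1..b}\<close>, the other for
    \<open>K\<close> blocks of length \<open>a\<close>. Rounding down loses at most another factor
    of 2, whence the 4.\<close>
  define K where "K = m div (2 * a)"
  have K: "K > 0" unfolding K_def using assms by (simp add: div_greater_zero_iff)
  have Ka: "K * a * 2 \<le> m" unfolding K_def
    using div_times_less_eq_dividend[of m "2 * a"] by (simp add: mult_ac)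
  have "m < (K + 1) * (2 * a)" unfolding K_def
    using assms dividend_less_div_times[of "2 * a" m] by simp
  also have "\<dots> \<le> (2 * K) * (2 * a)" using K by (intro mult_right_mono) auto
  finally have mK: "m \<le> K * (4 * a)" by simp
  define U where "U = pmf_of_set {..<K}"
  define A where "A = map_pmf (swap_block a b) U"
  have ne: "{..<K} \<noteq> {}" using K by auto
  have setU: "set_pmf U = {..<K}" unfolding U_def using ne by simp
  have "id_algorithm m A"
  proof -
    have "swap_block a b k permutes {1..m}" if "k < K" for k
    proof (rule swap_block_permutes)
      have "(k + 1) * a \<le> K * a" using that by (intro mult_right_mono) auto
      then show "b + k * a + a \<le> m" using Ka assms by simp
    qed (rule assms)
    then show ?thesis by (auto simp: id_algorithm_def A_def setU)
  qed
  then have "opt_collision_prob m [a, b] \<le> collision_prob A [a, b]"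
    by (rule opt_collision_prob_le)
  also have "\<dots> = measure_pmf.prob (pair_pmf U U)
      {(k, l). swap_block a b k ` {1..a} \<inter> swap_block a b l ` {1..b} \<noteq> {}}"
    unfolding collision_prob_pair A_def
    by (simp add: map_pair[symmetric] vimage_def case_prod_unfold)
  also have "\<dots> \<le> measure_pmf.prob (pair_pmf U U) {(k, l). k = l}"
    using swap_block_disjoint[OF assms(2)]
    by (intro measure_pmf.finite_measure_mono) auto
  also have "\<dots> = 1 / real K"
  proof -
    have "pair_pmf U U = pmf_of_set ({..<K} \<times> {..<K})"
    proof (rule pmf_eqI)
      have "pmf U k = indicator {..<K} k / real K" for k
        unfolding U_def using ne by simp
      then show "pmf (pair_pmf U U) i = pmf (pmf_of_set ({..<K} \<times> {..<K})) i" for i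
        using ne by (cases i) (simp add: pmf_pair indicator_times)
    qed
    moreover have "({..<K} \<times> {..<K}) \<inter> {(k, l). k = l} = (\<lambda>k. (k, k)) ` {..<K}" by auto
    moreover have "card ((\<lambda>k. (k, k)) ` {..<K}) = K" by (simp add: card_image inj_on_def)
    ultimately show ?thesis using ne by (simp add: measure_pmf_of_set)
  qed
  also have "\<dots> \<le> 4 * real a / real m"
  proof -
    have "real m \<le> real K * (4 * real a)" using of_nat_mono[OF mK, where 'a = real] by simp
    then show ?thesis using K assms by (simp add: field_simps)
  qed
  finally show ?thesis .
qed

section \<open>From the competitive ratio to collision probabilities\<close>

lemma finite_sqrt_pair_profiles: "finite (sqrt_pair_profiles m)"
proof -
  have "d \<le> m" if "real d \<le> sqrt (real m)" for d
  proof -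
    have "(real d)\<^sup>2 \<le> (sqrt (real m))\<^sup>2" using that by (intro power_mono) auto
    then have "d\<^sup>2 \<le> m" by (simp flip: of_nat_power)
    then show ?thesis by (rule power2_nat_le_imp_le)
  qed
  then have "sqrt_pair_profiles m \<subseteq> (\<lambda>(a, b). [a, b]) ` ({..m} \<times> {..m})"
    by (auto simp: sqrt_pair_profiles_def)
  then show ?thesis by (rule finite_subset) auto
qed

lemma competitive_ratio_ge:
  assumes "D \<in> sqrt_pair_profiles m"
  shows "collision_prob A D / opt_collision_prob m D \<le> competitive_ratio m A (sqrt_pair_profiles m)"
  unfolding competitive_ratio_def
  by (intro Max_ge finite_imageI finite_sqrt_pair_profiles imageI assms)

text \<open>Supplies the sign of the ratio for monotonicity, and finally absorbs the rounding of the
  logarithm.\<close>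

lemma competitive_ratio_ge_1:
  assumes "id_algorithm m A" "1 \<le> m"
  shows "1 \<le> competitive_ratio m A (sqrt_pair_profiles m)"
proof -
  have "1 \<le> collision_prob A [1, 1] / opt_collision_prob m [1, 1]"
    using opt_collision_prob_pos[of m 1 1] opt_collision_prob_le[OF assms(1)] assms(2) by simp
  also have "\<dots> \<le> competitive_ratio m A (sqrt_pair_profiles m)"
    using assms(2) by (intro competitive_ratio_ge) (auto simp: sqrt_pair_profiles_def)
  finally show ?thesis .
qed

lemma collision_prob_le_competitive_ratio:
  assumes A: "id_algorithm m A" and "2 \<le> b" "1 \<le> a" "a \<le> b" "b\<^sup>2 \<le> m"
  shows "collision_prob A [a, b] \<le>
    competitive_ratio m A (sqrt_pair_profiles m) * (4 * real a / real m)"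
proof -
  let ?R = "competitive_ratio m A (sqrt_pair_profiles m)"
  have "2 * b \<le> b\<^sup>2" using assms by (simp add: power2_eq_square)
  then have m: "2 * b \<le> m" using assms by simp
  have "real b \<le> sqrt (real m)"
    using assms(5) by (intro real_le_rsqrt) (metis of_nat_le_iff of_nat_power)
  then have "[a, b] \<in> sqrt_pair_profiles m"
    using assms by (auto simp: sqrt_pair_profiles_def)
  then have "collision_prob A [a, b] / opt_collision_prob m [a, b] \<le> ?R"
    by (rule competitive_ratio_ge)
  then have "collision_prob A [a, b] \<le> ?R * opt_collision_prob m [a, b]"
    using opt_collision_prob_pos[of m a b] assms m by (simp add: field_simps)
  also have "\<dots> \<le> ?R * (4 * real a / real m)"
    using competitive_ratio_ge_1[OF A] assms m
    by (intro mult_left_mono opt_collision_prob_upper) auto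
  finally show ?thesis .
qed

section \<open>Summation over dyadic blocks\<close>

lemma sum_half_power_dist:
  "(\<Sum>i<L. \<Sum>j<L. (1 / 2 :: real) ^ (max i j - min i j)) \<le> 3 * real L"
proof (induction L)
  case (Suc L)
  have half: "(\<Sum>i<n. (1 / 2 :: real) ^ (n - i)) = 1 - (1 / 2) ^ n" for n
  proof (induction n)
    case (Suc n)
    have "(\<Sum>i<Suc n. (1 / 2 :: real) ^ (Suc n - i)) = (\<Sum>i<n. (1 / 2) * (1 / 2) ^ (n - i)) + 1 / 2"
      by (simp add: Suc_diff_le)
    then show ?case using Suc by (simp add: sum_divide_distrib[symmetric])
  qed simp
  \<comment> \<open>The new row and the new column are geometric sums of at most 1 each; the new
    diagonal entry is 1. This makes 3 in total.\<close>
  have "(\<Sum>i<L. (1 / 2 :: real) ^ (max i L - min i L)) \<le> 1"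
    "(\<Sum>j<L. (1 / 2 :: real) ^ (max L j - min L j)) \<le> 1"
    using half[of L] by (simp_all add: max_def min_def)
  then show ?case using Suc by (simp add: sum.distrib)
qed simp

lemma competitive_ratio_ge_log4:
  assumes A: "id_algorithm m A" and m: "4 ^ L \<le> m"
  shows "real L \<le> 24 * competitive_ratio m A (sqrt_pair_profiles m)"
proof -
  define R where "R = competitive_ratio m A (sqrt_pair_profiles m)"
  define B :: "nat \<Rightarrow> nat set" where "B i = {2 ^ i..<2 ^ Suc i}" for i
  have m1: "1 \<le> m" using m by (metis one_le_power order_trans one_le_numeral)
  \<comment> \<open>Completing block \<open>i\<close> takes fewer than \<open>2 ^ Suc i\<close>
    requests; this demand is at most \<open>sqrt m\<close>, hence admissible in a profile.\<close>
  have sq: "(2 ^ Suc i)\<^sup>2 \<le> m" if "i < L" for i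
  proof -
    have "(2 ^ Suc i)\<^sup>2 = (4::nat) ^ Suc i"
      by (simp add: power2_eq_square power_mult_distrib[symmetric])
    also have "\<dots> \<le> 4 ^ L" using that by (intro power_increasing) auto
    finally show ?thesis using m by simp
  qed
  have le_m: "(2::nat) ^ Suc i \<le> m" if "i < L" for i
    using sq[OF that] power2_nat_le_imp_le by blast
  have Bsub: "B i \<subseteq> {1..2 ^ Suc i}" for i
    by (auto simp: B_def intro: order_trans[of _ "2 ^ i"])
  have Bm: "B i \<subseteq> {1..m}" if "i < L" for i
    using Bsub[of i] le_m[OF that] by fastforce
  have cardB: "card (B i) = 2 ^ i" for i by (simp add: B_def)
  \<comment> \<open>The 8 is the 4 from the optimum times 2, since the demand
    \<open>2 ^ Suc i\<close> is twice the size of block \<open>i\<close>.\<close>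
  have overlap: "(\<Sum>x\<in>{1..m}. hit_prob A (B i) x * hit_prob A (B j) x) \<le> 8 * R / m * 4 ^ i"
    if "i \<le> j" "j < L" for i j
  proof -
    have "(\<Sum>x\<in>{1..m}. hit_prob A (B i) x * hit_prob A (B j) x)
        \<le> 2 ^ i * collision_prob A [2 ^ Suc i, 2 ^ Suc j]"
      using sum_hit_prob_mult_le[OF A _ Bsub Bsub, of i j] Bm[of i] that cardB[of i] by simp
    also have "\<dots> \<le> 2 ^ i * (R * (4 * real (2 ^ Suc i) / real m))"
      unfolding R_def
      by (intro mult_left_mono collision_prob_le_competitive_ratio A sq that power_increasing)
         (use that in auto)
    also have "\<dots> = 8 * R / m * 4 ^ i"
      by (simp add: power_mult_distrib[symmetric] field_simps)
    finally show ?thesis .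
  qed
  have weighted_overlap: "(\<Sum>x\<in>{1..m}. (hit_prob A (B i) x / 2 ^ i) * (hit_prob A (B j) x / 2 ^ j))
      \<le> 8 * R / m * (1 / 2) ^ (max i j - min i j)" if "i < L" "j < L" for i j
    using that
  \<comment> \<open>Both sides are symmetric in \<open>i\<close> and \<open>j\<close>, so
    \<open>overlap\<close> for \<open>i \<le> j\<close> suffices.\<close>
  proof (induction i j rule: linorder_wlog)
    case (le i j)
    have "(\<Sum>x\<in>{1..m}. (hit_prob A (B i) x / 2 ^ i) * (hit_prob A (B j) x / 2 ^ j)) =
        (\<Sum>x\<in>{1..m}. hit_prob A (B i) x * hit_prob A (B j) x) / (2 ^ i * 2 ^ j)"
      by (simp add: sum_divide_distrib)
    also have "\<dots> \<le> 8 * R / m * 4 ^ i / (2 ^ i * 2 ^ j)"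
      using overlap le by (intro divide_right_mono) auto
    also have "\<dots> = 8 * R / m * (1 / 2) ^ (j - i)"
    proof -
      obtain d where "j = i + d" using le le_Suc_ex by blast
      then show ?thesis by (simp add: power_add power_divide power_mult_distrib[symmetric] field_simps)
    qed
    finally show ?case using le by (simp add: max_def min_def)
  next
    case (sym i j)
    then show ?case by (simp add: mult.commute max.commute min.commute)
  qed
  have "real L = (\<Sum>i<L. \<Sum>x\<in>{1..m}. hit_prob A (B i) x / 2 ^ i)"
    using sum_hit_prob[OF A Bm] by (simp add: sum_divide_distrib[symmetric] cardB)
  also have "\<dots> = (\<Sum>x\<in>{1..m}. \<Sum>i<L. hit_prob A (B i) x / 2 ^ i)"
    by (rule sum.swap)
  finally have "(real L)\<^sup>2 \<le> m * (\<Sum>x\<in>{1..m}. (\<Sum>i<L. hit_prob A (B i) x / 2 ^ i)\<^sup>2)"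
    using sum_squared_le_card[of "\<lambda>x. \<Sum>i<L. hit_prob A (B i) x / 2 ^ i" "{1..m}"] by simp
  also have "(\<Sum>x\<in>{1..m}. (\<Sum>i<L. hit_prob A (B i) x / 2 ^ i)\<^sup>2) =
      (\<Sum>i<L. \<Sum>j<L. \<Sum>x\<in>{1..m}. (hit_prob A (B i) x / 2 ^ i) * (hit_prob A (B j) x / 2 ^ j))"
    unfolding power2_eq_square sum_product
    by (subst sum.swap) (intro sum.cong refl sum.swap)
  also have "\<dots> \<le> (\<Sum>i<L. \<Sum>j<L. 8 * R / m * (1 / 2) ^ (max i j - min i j))"
    using weighted_overlap by (intro sum_mono) auto
  also have "\<dots> = 8 * R / m * (\<Sum>i<L. \<Sum>j<L. (1 / 2) ^ (max i j - min i j))"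
    by (simp add: sum_distrib_left)
  also have "\<dots> \<le> 8 * R / m * (3 * real L)"
    using competitive_ratio_ge_1[OF A m1] unfolding R_def
    by (intro mult_left_mono sum_half_power_dist) auto
  \<comment> \<open>The factor \<open>m\<close> from Cauchy-Schwarz cancels, and
    \<open>24 = 8 * 3\<close>.\<close>
  finally have "real L * real L \<le> 24 * R * real L"
    using m1 by (simp add: power2_eq_square mult_left_mono)
  then show ?thesis
    using competitive_ratio_ge_1[OF A m1] unfolding R_def by (cases "L = 0") auto
qed

theorem theorem3p10:
  "\<exists>c::real. c > 0 \<and>
     (\<forall>m::nat. m \<ge> 1 \<longrightarrow>
       (\<forall>A. id_algorithm m A \<longrightarrow>
         competitive_ratio m A (sqrt_pair_profiles m) \<ge> c * ln (real m)))"
proof (intro exI[of _ "1 / 96"] conjI allI impI)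
  fix m :: nat and A assume m: "1 \<le> m" and A: "id_algorithm m A"
  let ?R = "competitive_ratio m A (sqrt_pair_profiles m)"
  obtain L where L: "4 ^ L \<le> m" "m < 4 ^ (L + 1)"
    using ex_power_ivl1[of 4 m] m by auto
  have "real m \<le> 4 ^ (L + 1)"
    using L(2) by (metis less_imp_le of_nat_le_iff of_nat_power of_nat_numeral)
  then have "ln (real m) \<le> ln (4 ^ (L + 1))" using m by simp
  also have "\<dots> = (real L + 1) * ln 4" by (simp only: ln_realpow) simp
  also have "\<dots> \<le> (real L + 1) * 3" using ln_le_minus_one[of 4] by (intro mult_left_mono) auto
  \<comment> \<open>With \<open>L \<le> 24 * ?R\<close> and \<open>1 \<le> ?R\<close>, the bound
    \<open>3 * (L + 1)\<close> is at most \<open>75 * ?R\<close>; the constant 96 leaves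
    slack.\<close>
  finally show "1 / 96 * ln (real m) \<le> ?R"
    using competitive_ratio_ge_log4[OF A L(1)] competitive_ratio_ge_1[OF A m] by simp
qed simp

end
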